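(* Let $G$ be a König–Egerváry graph. Then: (i) for every $\alpha$-critical edge $e$ of $G$, the graph $G-e$ is also a König–Egerváry graph; (ii) every $\alpha$-critical edge of $G$ is also $\mu$-critical; (iii) the set of all $\alpha$-critical edges of $G$ is a matching (no two $\alpha$-critical edges share an endpoint).
   Context: All graphs are finite and simple; following the paper's standing convention, "graph" means a connected graph with at least one edge (the definitions below make sense for arbitrary finite simple graphs). $\alpha(G)$ is the stability number (maximum size of a stable set), $\mu(G)$ the size of a maximum matching, $n(G)=|V(G)|$. $G$ is a König–Egerváry graph if $\alpha(G)+\mu(G)=n(G)$. For an edge $e$, $G-e$ denotes the graph obtained by deleting $e$ (keeping all vertices). An edge $e$ is $\alpha$-critical if $\alpha(G-e)>\alpha(G)$, and $\mu$-critical if $\mu(G-e)<\mu(G)$. *)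

theory Defs
  imports Main
begin

text \<open>A graph is given by its vertex set \<open>V\<close> and its edge set \<open>E\<close>, an edge being the
  two-element set of its endpoints. Thus \<open>G - e\<close> is the pair \<open>V\<close>, \<open>E - {e}\<close>.\<close>

definition finite_simple_graph :: "'a set \<Rightarrow> 'a set set \<Rightarrow> bool" where
  "finite_simple_graph V E \<longleftrightarrow> finite V \<and> (\<forall>e\<in>E. e \<subseteq> V \<and> card e = 2)"

definition connected_graph :: "'a set \<Rightarrow> 'a set set \<Rightarrow> bool" where
  "connected_graph V E \<longleftrightarrow> V \<noteq> {} \<and> (\<forall>u\<in>V. \<forall>v\<in>V. (u, v) \<in> {(x, y). {x, y} \<in> E}\<^sup>*)"

definition stable_set :: "'a set \<Rightarrow> 'a set set \<Rightarrow> 'a set \<Rightarrow> bool" where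
  "stable_set V E S \<longleftrightarrow> S \<subseteq> V \<and> (\<forall>x\<in>S. \<forall>y\<in>S. {x, y} \<notin> E)"

definition matching :: "'a set set \<Rightarrow> 'a set set \<Rightarrow> bool" where
  "matching E M \<longleftrightarrow> M \<subseteq> E \<and> pairwise disjnt M"

definition stability_number :: "'a set \<Rightarrow> 'a set set \<Rightarrow> nat" where
  "stability_number V E = Max (card ` {S. stable_set V E S})"

definition matching_number :: "'a set set \<Rightarrow> nat" where
  "matching_number E = Max (card ` {M. matching E M})"

definition koenig_egervary :: "'a set \<Rightarrow> 'a set set \<Rightarrow> bool" where
  "koenig_egervary V E \<longleftrightarrow> stability_number V E + matching_number E = card V"

definition alpha_critical :: "'a set \<Rightarrow> 'a set set \<Rightarrow> 'a set \<Rightarrow> bool" where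
  "alpha_critical V E e \<longleftrightarrow> e \<in> E \<and> stability_number V (E - {e}) > stability_number V E"

definition mu_critical :: "'a set set \<Rightarrow> 'a set \<Rightarrow> bool" where
  "mu_critical E e \<longleftrightarrow> e \<in> E \<and> matching_number (E - {e}) < matching_number E"

end

theory Submission
  imports Defs
begin

text \<open>In every graph \<open>\<alpha> + \<mu> \<le> n\<close>, since each edge of a matching has an endpoint outside a given
  stable set. If \<open>G\<close> attains equality and deleting \<open>e\<close> increases \<open>\<alpha>\<close>, this bound for \<open>G - e\<close>
  forces \<open>\<mu>\<close> to drop; as it drops by at most one, \<open>G - e\<close> attains equality as well. Finally, a
  \<open>\<mu>\<close>-critical edge belongs to every maximum matching, so all the \<open>\<alpha>\<close>-critical edges lie in
  a single one.\<close>

lemma finite_simple_graph_finite_edges: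
  assumes "finite_simple_graph V E"
  shows "finite E"
proof (rule finite_subset)
  show "E \<subseteq> Pow V"
    using assms by (auto simp: finite_simple_graph_def)
  show "finite (Pow V)"
    using assms by (simp add: finite_simple_graph_def)
qed

lemma finite_simple_graph_subset:
  "finite_simple_graph V E \<Longrightarrow> F \<subseteq> E \<Longrightarrow> finite_simple_graph V F"
  by (auto simp: finite_simple_graph_def)

lemma finite_matchings:
  assumes "finite E"
  shows "finite {M. matching E M}"
  by (rule finite_subset[of _ "Pow E"]) (use assms in \<open>auto simp: matching_def\<close>)

text \<open>Disjointness concerns only the chosen edges, so the ambient edge set may change from
  \<open>E\<close> to \<open>F\<close>. With \<open>F = E - {e}\<close> this moves matchings to the
  graph after a deletion; with \<open>F = E\<close> it passes to a subset.\<close>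

lemma matching_subset: "matching E M \<Longrightarrow> N \<subseteq> M \<Longrightarrow> N \<subseteq> F \<Longrightarrow> matching F N"
  by (auto simp: matching_def intro: pairwise_subset)

lemma card_le_matching_number:
  assumes "finite E" "matching E M"
  shows "card M \<le> matching_number E"
  unfolding matching_number_def using assms by (auto intro: Max_ge simp: finite_matchings)

lemma ex_maximum_matching:
  assumes "finite E"
  obtains M where "matching E M" "card M = matching_number E"
proof -
  \<comment> \<open>The empty matching makes the set under \<open>Max\<close> nonempty, so the
    maximum is attained.\<close>
  have "matching E {}"
    by (simp add: matching_def)
  then have "matching_number E \<in> card ` {M. matching E M}"
    unfolding matching_number_def using finite_matchings[OF assms] by (intro Max_in) auto
  then show thesis
    using that by auto
qed

lemma ex_maximum_stable_set:
  assumes "finite V"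
  obtains S where "stable_set V E S" "card S = stability_number V E"
proof -
  have "finite {S. stable_set V E S}"
    by (rule finite_subset[of _ "Pow V"]) (use assms in \<open>auto simp: stable_set_def\<close>)
  moreover have "stable_set V E {}"
    by (simp add: stable_set_def)
  ultimately have "stability_number V E \<in> card ` {S. stable_set V E S}"
    unfolding stability_number_def by (intro Max_in) auto
  then show thesis
    using that by auto
qed

text \<open>Sending each edge of \<open>M\<close> to an endpoint outside \<open>S\<close> gives an
  injection of \<open>M\<close> into \<open>V - S\<close>, because distinct edges of
  \<open>M\<close> are disjoint.\<close>

lemma card_stable_set_add_card_matching_le:
  assumes G: "finite_simple_graph V E" and S: "stable_set V E S" and M: "matching E M"
  shows "card S + card M \<le> card V"
proof -
  have "finite V" "S \<subseteq> V"
    using G S by (auto simp: finite_simple_graph_def stable_set_def)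
  have "\<exists>v. v \<in> e \<and> v \<in> V - S" if "e \<in> M" for e
  proof -
    have "e \<in> E" "e \<subseteq> V" "card e = 2"
      using that M G by (auto simp: matching_def finite_simple_graph_def)
    moreover obtain x y where "e = {x, y}"
      using \<open>card e = 2\<close> by (auto simp: card_2_iff)
    ultimately show ?thesis
      using S by (auto simp: stable_set_def)
  qed
  then obtain f where f: "\<And>e. e \<in> M \<Longrightarrow> f e \<in> e \<and> f e \<in> V - S"
    by metis
  have "inj_on f M"
  proof (rule inj_onI, rule ccontr)
    fix e e' assume *: "e \<in> M" "e' \<in> M" "f e = f e'" "e \<noteq> e'"
    then have "disjnt e e'"
      using M by (auto simp: matching_def pairwise_def)
    then show False
      using f[of e] f[of e'] * by (auto simp: disjnt_iff)
  qed
  then have "card M \<le> card (V - S)"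
    using f \<open>finite V\<close> by (intro card_inj_on_le) auto
  \<comment> \<open>The inequality rules out truncation in the subtraction of naturals.\<close>
  moreover have "card (V - S) = card V - card S" "card S \<le> card V"
    using \<open>finite V\<close> \<open>S \<subseteq> V\<close> by (auto simp: card_Diff_subset finite_subset card_mono)
  ultimately show ?thesis
    by linarith
qed

lemma stability_number_add_matching_number_le:
  assumes "finite_simple_graph V E"
  shows "stability_number V E + matching_number E \<le> card V"
proof -
  have "finite V" "finite E"
    using assms finite_simple_graph_finite_edges by (auto simp: finite_simple_graph_def)
  obtain S where "stable_set V E S" "card S = stability_number V E"
    using ex_maximum_stable_set[OF \<open>finite V\<close>] .
  moreover obtain M where "matching E M" "card M = matching_number E"
    using ex_maximum_matching[OF \<open>finite E\<close>] .
  ultimately show ?thesis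
    using card_stable_set_add_card_matching_le[OF assms] by metis
qed

text \<open>Dropping \<open>e\<close> from a maximum matching costs at most one edge and leaves a
  matching of \<open>E - {e}\<close>.\<close>

lemma matching_number_le_Suc_delete:
  assumes "finite E"
  shows "matching_number E \<le> Suc (matching_number (E - {e}))"
proof -
  obtain M where M: "matching E M" "card M = matching_number E"
    using ex_maximum_matching[OF assms] .
  have "matching (E - {e}) (M - {e})"
    using M(1) by (intro matching_subset[OF M(1)]) (auto simp: matching_def)
  then have "card (M - {e}) \<le> matching_number (E - {e})"
    using assms by (simp add: card_le_matching_number)
  then show ?thesis
    using M(2) by (simp add: card_Diff_singleton_if split: if_splits)
qed

text \<open>A maximum matching avoiding \<open>e\<close> would survive the deletion of
  \<open>e\<close>, so \<mu> could not drop.\<close>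

lemma mu_critical_mem_maximum_matching:
  assumes "finite E" "mu_critical E e" and M: "matching E M" "card M = matching_number E"
  shows "e \<in> M"
proof (rule ccontr)
  assume "e \<notin> M"
  then have "matching (E - {e}) M"
    using M(1) by (intro matching_subset[OF M(1)]) (auto simp: matching_def)
  then have "card M \<le> matching_number (E - {e})"
    using assms(1) by (simp add: card_le_matching_number)
  then show False
    using assms(2) M(2) by (simp add: mu_critical_def)
qed

lemma koenig_egervary_alpha_critical:
  assumes G: "finite_simple_graph V E" and KE: "koenig_egervary V E" and e: "alpha_critical V E e"
  shows "koenig_egervary V (E - {e})" "mu_critical E e"
proof -
  have "stability_number V (E - {e}) + matching_number (E - {e}) \<le> card V"
    using finite_simple_graph_subset[OF G] by (intro stability_number_add_matching_number_le) auto
  moreover have "matching_number E \<le> Suc (matching_number (E - {e}))"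
    using G by (intro matching_number_le_Suc_delete finite_simple_graph_finite_edges)
  \<comment> \<open>Write \<alpha>', \<mu>' for the values after deletion. From \<alpha>' + \<mu>'
    \<le> n = \<alpha> + \<mu> and \<alpha>' \<ge> \<alpha> + 1 follows \<mu>' \<le> \<mu> - 1.
    Since also \<mu>' \<ge> \<mu> - 1, the sum \<alpha>' + \<mu>' is at least n, hence equal to
    n.\<close>
  ultimately show "koenig_egervary V (E - {e})" "mu_critical E e"
    using KE e by (auto simp: koenig_egervary_def alpha_critical_def mu_critical_def)
qed

theorem theorem2p3:
  fixes V :: "'a set" and E :: "'a set set"
  assumes "finite_simple_graph V E"
    and "connected_graph V E"
    and "E \<noteq> {}"
    and "koenig_egervary V E"
  shows "(\<forall>e. alpha_critical V E e \<longrightarrow> koenig_egervary V (E - {e}))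
    \<and> (\<forall>e. alpha_critical V E e \<longrightarrow> mu_critical E e)
    \<and> matching E {e. alpha_critical V E e}"
proof -
  note critical = koenig_egervary_alpha_critical[OF assms(1,4)]
  have "finite E"
    using assms(1) by (rule finite_simple_graph_finite_edges)
  then obtain M where M: "matching E M" "card M = matching_number E"
    by (rule ex_maximum_matching)
  \<comment> \<open>\<open>M\<close> is fixed before any edge is considered, so the same matching
    contains all these edges.\<close>
  have "{e. alpha_critical V E e} \<subseteq> M"
    using mu_critical_mem_maximum_matching[OF \<open>finite E\<close> _ M] critical(2) by blast
  then have "matching E {e. alpha_critical V E e}"
    by (rule matching_subset[OF M(1)]) (auto simp: alpha_critical_def)
  then show ?thesis
    using critical by blast
qed

end
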